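(* Let $\Gamma$ be an edgeless graph on $n$ vertices, and suppose that a finite group $G$ acts on $V(\Gamma)$. Then, for every $g\in G$, the quotient $\Gamma/g$ is edgeless and has $\#\mathrm{Orb}_{\langle g\rangle}(V(\Gamma))$ vertices. Hence $$P_{\Gamma/g}(x,y)=x^{\,\#\mathrm{Orb}_{\langle g\rangle}(V(\Gamma))}.$$ Consequently, $$F_{\Gamma}(G;x,y)=\sum_{g\in G}c_G(g)\,x^{\,\#\mathrm{Orb}_{\langle g\rangle}(V(\Gamma))},\qquad\text{where } c_G(g):=\sum_{\substack{H\leq G\\ g\in H}}\frac1{|H|}.$$
   Context: Graphs are finite and undirected; loops are allowed and parallel edges are irrelevant (only adjacency matters); an edgeless graph has no edges and no loops. $\#\mathrm{Orb}_{\langle g\rangle}(V(\Gamma))$ denotes the number of orbits of the cyclic group $\langle g\rangle$ on $V(\Gamma)$. For a graph $\Lambda$, the bivariate chromatic polynomial $P_\Lambda(x,y)$ (Dohmen–Pönitz–Tittmann) is the unique polynomial in $x,y$ such that, for all integers $x\ge y\ge 0$, $P_\Lambda(x,y)$ is the number of maps $c:V(\Lambda)\to\{1,\dots,x\}$ such that for every edge $uv$ of $\Lambda$ (including loops, $u=v$) with $c(u)=c(v)$ one has $c(u)>y$. Thus colours $1,\dots,y$ are "proper", colours $y+1,\dots,x$ are "improper", and a vertex carrying a loop can only receive an improper colour. For $g\in G$, the quotient graph $\Gamma/g$ has as vertices the $\langle g\rangle$-orbits on $V(\Gamma)$; two distinct orbits are adjacent iff at least one edge of $\Gamma$ joins them,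 and an orbit carries a loop iff some edge of $\Gamma$ has both endpoints in that orbit. The multiorbital bivariate chromatic polynomial of $\Gamma$ relative to $G$ is $$F_\Gamma(G;x,y):=\sum_{H\le G}\frac1{|H|}\sum_{h\in H}P_{\Gamma/h}(x,y),$$ the outer sum being over all subgroups $H$ of $G$. Identities are identities of polynomials in $x,y$ with rational coefficients. *)

theory Defs
  imports
    "HOL-Algebra.Group_Action"
    "HOL-Algebra.Generated_Groups"
    "HOL-Computational_Algebra.Polynomial"
    "HOL-Library.FuncSet"
    "Graph_Theory.Pair_Digraph"
begin

text \<open>
  A finite undirected graph with loops allowed and parallel edges ignored is a
  \<^locale>\<open>pair_pseudo_graph\<close>: a finite vertex set with a symmetric adjacency
  relation on it.  A loop at \<open>v\<close> is the pair \<open>(v, v)\<close>.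
\<close>

definition edgeless :: "'v pair_pre_digraph \<Rightarrow> bool" where
  "edgeless \<Gamma> \<longleftrightarrow> parcs \<Gamma> = {}"

definition cyclic_orbits ::
  "('g, 'm) monoid_scheme \<Rightarrow> ('g \<Rightarrow> 'v \<Rightarrow> 'v) \<Rightarrow> 'v pair_pre_digraph \<Rightarrow> 'g \<Rightarrow> 'v set set" where
  "cyclic_orbits G \<phi> \<Gamma> g = orbits (G\<lparr>carrier := generate G {g}\<rparr>) (pverts \<Gamma>) \<phi>"

text \<open>The case \<open>A = B\<close> is the rule for loops: an edge with both ends in \<open>A\<close>.\<close>

definition quotient_graph ::
  "('g, 'm) monoid_scheme \<Rightarrow> ('g \<Rightarrow> 'v \<Rightarrow> 'v) \<Rightarrow> 'v pair_pre_digraph \<Rightarrow> 'g \<Rightarrow> 'v set pair_pre_digraph" where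
  "quotient_graph G \<phi> \<Gamma> g =
     \<lparr> pverts = cyclic_orbits G \<phi> \<Gamma> g,
       parcs = {(A, B). A \<in> cyclic_orbits G \<phi> \<Gamma> g \<and> B \<in> cyclic_orbits G \<phi> \<Gamma> g \<and>
                        (\<exists>u\<in>A. \<exists>v\<in>B. (u, v) \<in> parcs \<Gamma>)} \<rparr>"

lemma pair_pseudo_graph_quotient_graph:
  assumes "pair_pseudo_graph \<Gamma>"
  shows "pair_pseudo_graph (quotient_graph G \<phi> \<Gamma> g)"
proof -
  interpret pair_pseudo_graph \<Gamma> by fact
  have fin: "finite (cyclic_orbits G \<phi> \<Gamma> g)"
    using pair_finite_verts by (simp add: cyclic_orbits_def orbits_def)
  have sym: "sym (parcs \<Gamma>)"
    using pair_sym_arcs by (simp add: symmetric_def)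
  show ?thesis
  proof
    show "finite (parcs (quotient_graph G \<phi> \<Gamma> g))"
      by (rule finite_subset[OF _ finite_cartesian_product[OF fin fin]])
         (auto simp: quotient_graph_def)
    show "symmetric (with_proj (quotient_graph G \<phi> \<Gamma> g))"
      using sym by (auto simp: symmetric_def quotient_graph_def sym_def)
  qed (auto simp: quotient_graph_def fin)
qed

text \<open>
  Polynomials in \<open>x, y\<close> with rational coefficients are elements of
  \<open>\<rat>[y][x]\<close>: the outer variable is \<open>x\<close>, and \<open>y\<close> lives in the coefficients.
\<close>

definition poly_x :: "rat poly poly" where
  "poly_x = [:0, 1:]"

definition eval_xy :: "rat poly poly \<Rightarrow> rat \<Rightarrow> rat \<Rightarrow> rat" where
  "eval_xy p x y = poly (poly p [:x:]) y"

definition bivariate_colourings :: "'v pair_pre_digraph \<Rightarrow> nat \<Rightarrow> nat \<Rightarrow> ('v \<Rightarrow> nat) set" where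
  "bivariate_colourings \<Lambda> x y =
     {c \<in> pverts \<Lambda> \<rightarrow>\<^sub>E {1..x}. \<forall>(u, v) \<in> parcs \<Lambda>. c u = c v \<longrightarrow> c u > y}"

definition bivariate_chromatic_poly :: "'v pair_pre_digraph \<Rightarrow> rat poly poly" where
  "bivariate_chromatic_poly \<Lambda> =
     (THE p. \<forall>x y. y \<le> x \<longrightarrow>
        eval_xy p (of_nat x) (of_nat y) = of_nat (card (bivariate_colourings \<Lambda> x y)))"

definition multiorbital_poly ::
  "('g, 'm) monoid_scheme \<Rightarrow> ('g \<Rightarrow> 'v \<Rightarrow> 'v) \<Rightarrow> 'v pair_pre_digraph \<Rightarrow> rat poly poly" where
  "multiorbital_poly G \<phi> \<Gamma> =
     (\<Sum>H | subgroup H G. smult [:1 / of_nat (card H):]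
        (\<Sum>h\<in>H. bivariate_chromatic_poly (quotient_graph G \<phi> \<Gamma> h)))"

definition subgroup_weight :: "('g, 'm) monoid_scheme \<Rightarrow> 'g \<Rightarrow> rat" where
  "subgroup_weight G g = (\<Sum>H | subgroup H G \<and> g \<in> H. 1 / of_nat (card H))"

end

theory Submission
  imports Defs
begin

text \<open>
  With no edges there is no constraint on colourings, so an edgeless graph on \<open>k\<close> vertices has
  \<open>x ^ k\<close> colourings whatever \<open>y\<close> is, and the quotients of an edgeless graph are edgeless.
  What needs an argument is that \<open>x ^ k\<close> therefore \<^emph>\<open>is\<close> the bivariate chromatic polynomial, which
  is specified only through its values at the lattice points with \<open>y \<le> x\<close>: these points determine
  a polynomial (\<open>eval_xy_wedge_unique\<close>), because each horizontal line \<open>y = const\<close> carries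
  infinitely many of them and there are infinitely many such lines.

  The formula for the multiorbital polynomial then comes from exchanging the sums over pairs
  \<open>h \<in> H\<close> (\<open>multiorbital_poly_eq_sum_elements\<close>), which holds for every graph: the weight of \<open>g\<close>
  collects the factors \<open>1 / |H|\<close> of the subgroups containing \<open>g\<close>.
\<close>

text \<open>
  Specialising \<open>y\<close> first gives a polynomial in \<open>x\<close> alone, so that facts on the roots of univariate
  polynomials become available on each line \<open>y = const\<close>.
\<close>

lemma eval_xy_eq_poly_map_poly:
  "eval_xy p x y = poly (map_poly (\<lambda>c. poly c y) p) x"
  unfolding eval_xy_def by (induction p) (simp_all add: map_poly_pCons)

lemma poly_eq_0_if_vanishing_from:
  fixes p :: "'a::{idom, ring_char_0} poly"
  assumes "\<And>k::nat. k \<ge> m \<Longrightarrow> poly p (of_nat k) = 0"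
  shows "p = 0"
proof (rule ccontr)
  assume "p \<noteq> 0"
  then have "finite {z. poly p z = 0}"
    by (rule poly_roots_finite)
  moreover have "of_nat ` {m..} \<subseteq> {z. poly p z = 0}"
    using assms by auto
  ultimately have "finite (of_nat ` {m..} :: 'a set)"
    by (rule rev_finite_subset)
  then have "finite {m..}"
    by (rule finite_imageD) (simp add: inj_on_def)
  then show False
    by (simp add: infinite_Ici)
qed

text \<open>
  On the line through \<open>y\<close> the lattice points \<open>x \<ge> y\<close> force the specialised polynomial to vanish
  identically; hence every coefficient, a polynomial in \<open>y\<close>, vanishes at all natural numbers.
\<close>

lemma eval_xy_wedge_eq_0:
  assumes "\<And>x y::nat. y \<le> x \<Longrightarrow> eval_xy p (of_nat x) (of_nat y) = 0"
  shows "p = 0"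
proof (rule poly_eqI)
  fix i
  have "poly (coeff p i) (of_nat y) = 0" for y :: nat
  proof -
    have "map_poly (\<lambda>c. poly c (of_nat y)) p = 0"
      using assms by (intro poly_eq_0_if_vanishing_from[of y]) (simp add: eval_xy_eq_poly_map_poly)
    then have "coeff (map_poly (\<lambda>c. poly c (of_nat y)) p) i = 0"
      by simp
    then show ?thesis
      by (simp add: coeff_map_poly)
  qed
  then show "coeff p i = coeff 0 i"
    using poly_eq_0_if_vanishing_from[of 0 "coeff p i"] by simp
qed

lemma eval_xy_wedge_unique:
  assumes "\<And>x y::nat. y \<le> x \<Longrightarrow>
    eval_xy p (of_nat x) (of_nat y) = eval_xy q (of_nat x) (of_nat y)"
  shows "p = q"
proof -
  have "p - q = 0"
    using assms by (intro eval_xy_wedge_eq_0) (simp add: eval_xy_def)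
  then show ?thesis by simp
qed

text \<open>
  The definite description in \<^const>\<open>bivariate_chromatic_poly\<close> is resolved here: any polynomial
  with the right values on the wedge \<open>y \<le> x\<close> is the one described.
\<close>

lemma bivariate_chromatic_poly_eqI:
  assumes "\<And>x y::nat. y \<le> x \<Longrightarrow>
    eval_xy p (of_nat x) (of_nat y) = of_nat (card (bivariate_colourings \<Lambda> x y))"
  shows "bivariate_chromatic_poly \<Lambda> = p"
  unfolding bivariate_chromatic_poly_def
  using assms by (intro the_equality) (auto intro!: eval_xy_wedge_unique)

lemma eval_xy_poly_x_power: "eval_xy (poly_x ^ k) x y = x ^ k"
  by (simp add: eval_xy_def poly_x_def)

lemma bivariate_chromatic_poly_edgeless:
  assumes "edgeless \<Lambda>" and "finite (pverts \<Lambda>)"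
  shows "bivariate_chromatic_poly \<Lambda> = poly_x ^ card (pverts \<Lambda>)"
proof (rule bivariate_chromatic_poly_eqI)
  fix x y :: nat
  have "bivariate_colourings \<Lambda> x y = pverts \<Lambda> \<rightarrow>\<^sub>E {1..x}"
    using assms(1) by (auto simp: bivariate_colourings_def edgeless_def)
  then show "eval_xy (poly_x ^ card (pverts \<Lambda>)) (of_nat x) (of_nat y)
      = of_nat (card (bivariate_colourings \<Lambda> x y))"
    using assms(2) by (simp add: eval_xy_poly_x_power card_PiE)
qed

lemma edgeless_quotient_graph:
  "edgeless \<Gamma> \<Longrightarrow> edgeless (quotient_graph G \<phi> \<Gamma> g)"
  by (simp add: edgeless_def quotient_graph_def)

lemma pverts_quotient_graph: "pverts (quotient_graph G \<phi> \<Gamma> g) = cyclic_orbits G \<phi> \<Gamma> g"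
  by (simp add: quotient_graph_def)

lemma finite_cyclic_orbits:
  "finite (pverts \<Gamma>) \<Longrightarrow> finite (cyclic_orbits G \<phi> \<Gamma> g)"
  by (simp add: cyclic_orbits_def orbits_def)

lemma smult_sum_right: "smult c (\<Sum>i\<in>A. f i) = (\<Sum>i\<in>A. smult c (f i))"
  by (induction A rule: infinite_finite_induct) (simp_all add: smult_add_right)

lemma multiorbital_poly_eq_sum_elements:
  assumes "finite (carrier G)"
  shows "multiorbital_poly G \<phi> \<Gamma> =
    (\<Sum>g\<in>carrier G. smult [:subgroup_weight G g:]
        (bivariate_chromatic_poly (quotient_graph G \<phi> \<Gamma> g)))"
proof -
  let ?S = "{H. subgroup H G}"
  let ?P = "\<lambda>g. bivariate_chromatic_poly (quotient_graph G \<phi> \<Gamma> g)"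
  let ?w = "\<lambda>H. 1 / of_nat (card H) :: rat"
  have fin: "finite ?S"
    using assms by (rule finite_subset[rotated, OF finite_Pow_iff[THEN iffD2]])
      (auto dest: subgroup.subset)
  have inner: "smult [:?w H:] (\<Sum>h\<in>H. ?P h) = (\<Sum>h | h \<in> carrier G \<and> h \<in> H. smult [:?w H:] (?P h))"
    if "H \<in> ?S" for H
  proof -
    have "{h. h \<in> carrier G \<and> h \<in> H} = H"
      using that by (auto dest: subgroup.mem_carrier)
    then show ?thesis
      by (simp add: smult_sum_right)
  qed
  have "multiorbital_poly G \<phi> \<Gamma> = (\<Sum>H\<in>?S. \<Sum>h | h \<in> carrier G \<and> h \<in> H. smult [:?w H:] (?P h))"
    unfolding multiorbital_poly_def by (intro sum.cong refl inner)
  also have "\<dots> = (\<Sum>g\<in>carrier G. \<Sum>H | H \<in> ?S \<and> g \<in> H. smult [:?w H:] (?P g))"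
    by (rule sum.swap_restrict[OF fin assms])
  also have "\<dots> = (\<Sum>g\<in>carrier G. smult [:subgroup_weight G g:] (?P g))"
    by (simp add: subgroup_weight_def flip: sum_to_poly smult_sum)
  finally show ?thesis .
qed

theorem proposition3p15:
  fixes \<Gamma> :: "'v pair_pre_digraph"
    and G :: "('g, 'm) monoid_scheme"
    and \<phi> :: "'g \<Rightarrow> 'v \<Rightarrow> 'v"
    and n :: nat
  assumes "pair_pseudo_graph \<Gamma>"
    and "edgeless \<Gamma>"
    and "card (pverts \<Gamma>) = n"
    and "finite (carrier G)"
    and "group_action G (pverts \<Gamma>) \<phi>"
  shows "(\<forall>g \<in> carrier G.
            edgeless (quotient_graph G \<phi> \<Gamma> g) \<and>
            card (pverts (quotient_graph G \<phi> \<Gamma> g)) = card (cyclic_orbits G \<phi> \<Gamma> g) \<and>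
            bivariate_chromatic_poly (quotient_graph G \<phi> \<Gamma> g)
              = poly_x ^ card (cyclic_orbits G \<phi> \<Gamma> g)) \<and>
         multiorbital_poly G \<phi> \<Gamma>
           = (\<Sum>g \<in> carrier G.
                smult [:subgroup_weight G g:] (poly_x ^ card (cyclic_orbits G \<phi> \<Gamma> g)))"
proof -
  interpret pair_pseudo_graph \<Gamma> by fact
  have "bivariate_chromatic_poly (quotient_graph G \<phi> \<Gamma> g) = poly_x ^ card (cyclic_orbits G \<phi> \<Gamma> g)"
    for g
    using bivariate_chromatic_poly_edgeless[OF edgeless_quotient_graph[OF assms(2)]]
    by (simp add: pverts_quotient_graph finite_cyclic_orbits)
  then show ?thesis
    using assms(2,4)
    by (simp add: edgeless_quotient_graph pverts_quotient_graph multiorbital_poly_eq_sum_elements)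
qed

end
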